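(* The discrete cost functional $\mathcal{L}^\alpha_h$ has a discrete critical point in $(\mathbb{R}^m)^{N+1}$ if and only if there exists $(Q,U,P)\in(\mathbb{R}^d)^{N+1}\times(\mathbb{R}^m)^{N+1}\times(\mathbb{R}^d)^{N+1}$ solution of the following shifted discrete fractional Pontryagin's system: $$\left\{\begin{array}{ll}({}_{\mathrm{c}}\Delta^\alpha_-Q)_k=\dfrac{\partial H}{\partial w}(Q_k,U_k,P_{k-1},t_k), & k=1,\dots,N,\\[8pt](\Delta^\alpha_+P)_k=\dfrac{\partial H}{\partial x}(Q_{k+1},U_{k+1},P_k,t_{k+1}), & k=0,\dots,N-1,\\[8pt]\dfrac{\partial H}{\partial v}(Q_k,U_k,P_{k-1},t_k)=0, & k=1,\dots,N,\\[8pt](Q_0,P_N)=(A,0).\end{array}\right.$$ In this case, for such a solution $(Q,U,P)$, $U$ is a discrete critical point of $\mathcal{L}^\alpha_h$ and $(Q,P)=(Q^{U,\alpha},P^{U,\alpha})$.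
   Context: Setting. $a<b$ are reals, $d,m\in\mathbb{N}^*$, $0<\alpha\le1$, $A\in\mathbb{R}^d$, $N\in\mathbb{N}^*$, $h=(b-a)/N$, $t_k=a+kh$ for $k=0,\dots,N$. The constraint function $f:\mathbb{R}^d\times\mathbb{R}^m\times[a,b]\to\mathbb{R}^d$, $(x,v,t)\mapsto f(x,v,t)$, is $C^2$ and there is $M\ge0$ with $\|f(x_1,v,t)-f(x_2,v,t)\|\le M\|x_1-x_2\|$ for all $x_1,x_2,v,t$ (Euclidean norm). The Lagrangian $L:\mathbb{R}^d\times\mathbb{R}^m\times[a,b]\to\mathbb{R}$, $(x,v,t)\mapsto L(x,v,t)$, is $C^2$. It is assumed that $2h^\alpha M<1$. The Hamiltonian is $H(x,v,w,t)=L(x,v,t)+w\cdot f(x,v,t)$ on $\mathbb{R}^d\times\mathbb{R}^m\times\mathbb{R}^d\times[a,b]$. Discrete derivatives. Let $\alpha_0=1$ and $\alpha_r=\frac{(-\alpha)(1-\alpha)\cdots(r-1-\alpha)}{r!}$ for $r\ge1$. For $G\in(\mathbb{R}^d)^{N+1}$: $({}_{\mathrm{c}}\Delta^\alpha_-G)_k=h^{-\alpha}\sum_{r=0}^k\alpha_r(G_{k-r}-G_0)$ for $k=1,\dots,N$; $(\Delta^\alpha_+G)_k=h^{-\alpha}\sum_{r=0}^{N-k}\alpha_rG_{k+r}$ and $({}_{\mathrm{c}}\Delta^\alpha_+G)_k=h^{-\alpha}\sum_{r=0}^{N-k}\alpha_r(G_{k+r}-G_N)$ for $k=0,\dots,N-1$.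 State and adjoint variables. For $U\in(\mathbb{R}^m)^{N+1}$ (a discrete control), $Q^{U,\alpha}\in(\mathbb{R}^d)^{N+1}$ is the unique solution of $({}_{\mathrm{c}}\Delta^\alpha_-Q)_k=f(Q_k,U_k,t_k)$, $k=1,\dots,N$, $Q_0=A$; and $P^{U,\alpha}\in(\mathbb{R}^d)^{N+1}$ is the unique solution of $({}_{\mathrm{c}}\Delta^\alpha_+P)_k=\frac{\partial H}{\partial x}(Q^{U,\alpha}_{k+1},U_{k+1},P_k,t_{k+1})$, $k=0,\dots,N-1$, $P_N=0$. (Existence and uniqueness hold under the assumptions above.) Discrete cost functional: $\mathcal{L}^\alpha_h:(\mathbb{R}^m)^{N+1}\to\mathbb{R}$, $\mathcal{L}^\alpha_h(U)=h\sum_{k=1}^NL(Q^{U,\alpha}_k,U_k,t_k)$. A discrete critical point of $\mathcal{L}^\alpha_h$ is $U\in(\mathbb{R}^m)^{N+1}$ such that for all $\bar U\in(\mathbb{R}^m)^{N+1}$, $D\mathcal{L}^\alpha_h(U)(\bar U):=\lim_{\varepsilon\to0}\frac{\mathcal{L}^\alpha_h(U+\varepsilon\bar U)-\mathcal{L}^\alpha_h(U)}{\varepsilon}=0$. *)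

theory Defs
  imports "HOL-Analysis.Analysis"
begin

text \<open>\<open>tuples N\<close> is \<open>X\<^sup>N\<^sup>+\<^sup>1\<close>, indexed by \<open>0, \<dots>, N\<close>. Its elements are extensional
  functions, so that equality of tuples is equality of functions.\<close>

definition tuples :: "nat \<Rightarrow> (nat \<Rightarrow> 'a) set" where
  "tuples N = {0..N} \<rightarrow>\<^sub>E UNIV"

text \<open>Class \<open>C\<^sup>2\<close> on a set \<open>S\<close>, with Frechet derivatives taken relative to \<open>S\<close>. It is used for
  \<open>S = UNIV \<times> UNIV \<times> {a..b}\<close>, a convex set with nonempty interior for \<open>a < b\<close>, where these
  derivatives are unique; at the two end times they are one-sided in the time variable.\<close>

definition C2_on :: "('a::real_normed_vector \<Rightarrow> 'b::real_normed_vector) \<Rightarrow> 'a set \<Rightarrow> bool" where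
  "C2_on g S \<longleftrightarrow>
    (\<exists>(g' :: 'a \<Rightarrow> 'a \<Rightarrow>\<^sub>L 'b) (g'' :: 'a \<Rightarrow> 'a \<Rightarrow>\<^sub>L ('a \<Rightarrow>\<^sub>L 'b)).
      (\<forall>z\<in>S. (g has_derivative blinfun_apply (g' z)) (at z within S)) \<and>
      (\<forall>z\<in>S. (g' has_derivative blinfun_apply (g'' z)) (at z within S)) \<and>
      continuous_on S g'')"

definition gradient :: "('a::real_inner \<Rightarrow> real) \<Rightarrow> 'a \<Rightarrow> 'a" where
  "gradient g x = (THE D. GDERIV g x :> D)"

definition mesh :: "real \<Rightarrow> real \<Rightarrow> nat \<Rightarrow> real" where
  "mesh a b N = (b - a) / real N"

definition node :: "real \<Rightarrow> real \<Rightarrow> nat \<Rightarrow> nat \<Rightarrow> real" where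
  "node a b N k = a + real k * mesh a b N"

text \<open>\<open>pochhammer (-\<alpha>) r = (-\<alpha>) (1 - \<alpha>) \<cdots> (r - 1 - \<alpha>)\<close>\<close>

definition gl_coeff :: "real \<Rightarrow> nat \<Rightarrow> real" where
  "gl_coeff \<alpha> r = pochhammer (- \<alpha>) r / fact r"

definition caputo_minus ::
  "real \<Rightarrow> real \<Rightarrow> (nat \<Rightarrow> 'a::real_vector) \<Rightarrow> nat \<Rightarrow> 'a" where
  "caputo_minus h \<alpha> G k =
    h powr (- \<alpha>) *\<^sub>R (\<Sum>r=0..k. gl_coeff \<alpha> r *\<^sub>R (G (k - r) - G 0))"

definition delta_plus ::
  "real \<Rightarrow> nat \<Rightarrow> real \<Rightarrow> (nat \<Rightarrow> 'a::real_vector) \<Rightarrow> nat \<Rightarrow> 'a" where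
  "delta_plus h N \<alpha> G k =
    h powr (- \<alpha>) *\<^sub>R (\<Sum>r=0..N - k. gl_coeff \<alpha> r *\<^sub>R G (k + r))"

definition caputo_plus ::
  "real \<Rightarrow> nat \<Rightarrow> real \<Rightarrow> (nat \<Rightarrow> 'a::real_vector) \<Rightarrow> nat \<Rightarrow> 'a" where
  "caputo_plus h N \<alpha> G k =
    h powr (- \<alpha>) *\<^sub>R (\<Sum>r=0..N - k. gl_coeff \<alpha> r *\<^sub>R (G (k + r) - G N))"

type_synonym ('d, 'm) dynamics = "real^'d \<Rightarrow> real^'m \<Rightarrow> real \<Rightarrow> real^'d"
type_synonym ('d, 'm) lagrangian = "real^'d \<Rightarrow> real^'m \<Rightarrow> real \<Rightarrow> real"

definition hamiltonian :: "('d::finite, 'm::finite) lagrangian \<Rightarrow> ('d, 'm) dynamics \<Rightarrow>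
    real^'d \<Rightarrow> real^'m \<Rightarrow> real^'d \<Rightarrow> real \<Rightarrow> real" where
  "hamiltonian L f x v w t = L x v t + w \<bullet> f x v t"

definition dH_dx :: "('d::finite, 'm::finite) lagrangian \<Rightarrow> ('d, 'm) dynamics \<Rightarrow>
    real^'d \<Rightarrow> real^'m \<Rightarrow> real^'d \<Rightarrow> real \<Rightarrow> real^'d" where
  "dH_dx L f x v w t = gradient (\<lambda>y. hamiltonian L f y v w t) x"

definition dH_dv :: "('d::finite, 'm::finite) lagrangian \<Rightarrow> ('d, 'm) dynamics \<Rightarrow>
    real^'d \<Rightarrow> real^'m \<Rightarrow> real^'d \<Rightarrow> real \<Rightarrow> real^'m" where
  "dH_dv L f x v w t = gradient (\<lambda>y. hamiltonian L f x y w t) v"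

definition dH_dw :: "('d::finite, 'm::finite) lagrangian \<Rightarrow> ('d, 'm) dynamics \<Rightarrow>
    real^'d \<Rightarrow> real^'m \<Rightarrow> real^'d \<Rightarrow> real \<Rightarrow> real^'d" where
  "dH_dw L f x v w t = gradient (\<lambda>y. hamiltonian L f x v y t) w"

definition state :: "real \<Rightarrow> real \<Rightarrow> nat \<Rightarrow> real \<Rightarrow> real^'d \<Rightarrow>
    ('d::finite, 'm::finite) dynamics \<Rightarrow> (nat \<Rightarrow> real^'m) \<Rightarrow> nat \<Rightarrow> real^'d" where
  "state a b N \<alpha> A f U = (THE Q. Q \<in> tuples N \<and>
    (\<forall>k\<in>{1..N}. caputo_minus (mesh a b N) \<alpha> Q k = f (Q k) (U k) (node a b N k)) \<and>
    Q 0 = A)"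

definition adjoint_state :: "real \<Rightarrow> real \<Rightarrow> nat \<Rightarrow> real \<Rightarrow> real^'d \<Rightarrow>
    ('d::finite, 'm::finite) lagrangian \<Rightarrow> ('d, 'm) dynamics \<Rightarrow>
    (nat \<Rightarrow> real^'m) \<Rightarrow> nat \<Rightarrow> real^'d" where
  "adjoint_state a b N \<alpha> A L f U = (THE P. P \<in> tuples N \<and>
    (\<forall>k\<in>{0..<N}. caputo_plus (mesh a b N) N \<alpha> P k =
      dH_dx L f (state a b N \<alpha> A f U (k + 1)) (U (k + 1)) (P k) (node a b N (k + 1))) \<and>
    P N = 0)"

definition cost :: "real \<Rightarrow> real \<Rightarrow> nat \<Rightarrow> real \<Rightarrow> real^'d \<Rightarrow>
    ('d::finite, 'm::finite) lagrangian \<Rightarrow> ('d, 'm) dynamics \<Rightarrow> (nat \<Rightarrow> real^'m) \<Rightarrow> real" where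
  "cost a b N \<alpha> A L f U =
    mesh a b N * (\<Sum>k=1..N. L (state a b N \<alpha> A f U k) (U k) (node a b N k))"

definition critical_point :: "nat \<Rightarrow> ((nat \<Rightarrow> 'a::real_vector) \<Rightarrow> real) \<Rightarrow>
    (nat \<Rightarrow> 'a) \<Rightarrow> bool" where
  "critical_point N J U \<longleftrightarrow> U \<in> tuples N \<and>
    (\<forall>V\<in>tuples N.
      ((\<lambda>\<epsilon>::real. (J (\<lambda>k\<in>{0..N}. U k + \<epsilon> *\<^sub>R V k) - J U) / \<epsilon>) \<longlongrightarrow> 0) (at 0))"

definition pontryagin_solution :: "real \<Rightarrow> real \<Rightarrow> nat \<Rightarrow> real \<Rightarrow> real^'d \<Rightarrow>
    ('d::finite, 'm::finite) lagrangian \<Rightarrow> ('d, 'm) dynamics \<Rightarrow>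
    (nat \<Rightarrow> real^'d) \<Rightarrow> (nat \<Rightarrow> real^'m) \<Rightarrow> (nat \<Rightarrow> real^'d) \<Rightarrow> bool" where
  "pontryagin_solution a b N \<alpha> A L f Q U P \<longleftrightarrow>
    Q \<in> tuples N \<and> U \<in> tuples N \<and> P \<in> tuples N \<and>
    (\<forall>k\<in>{1..N}. caputo_minus (mesh a b N) \<alpha> Q k =
      dH_dw L f (Q k) (U k) (P (k - 1)) (node a b N k)) \<and>
    (\<forall>k\<in>{0..<N}. delta_plus (mesh a b N) N \<alpha> P k =
      dH_dx L f (Q (k + 1)) (U (k + 1)) (P k) (node a b N (k + 1))) \<and>
    (\<forall>k\<in>{1..N}. dH_dv L f (Q k) (U k) (P (k - 1)) (node a b N k) = 0) \<and>
    Q 0 = A \<and> P N = 0"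

end

theory Submission imports Defs begin

text \<open>The state, the linearised state and the time-reversed adjoint state all solve a recursion in
  which each value is the fixed point of a contraction depending on the earlier values. Perturbing
  the control by \<open>\<epsilon>V\<close> perturbs this contraction, and its fixed point is differentiable in \<open>\<epsilon>\<close>
  with the linearised state \<open>X\<close> as derivative. Discrete summation by parts trades \<open>X\<close> for the adjoint state
  \<open>P\<close>, so that the derivative of the cost along \<open>V\<close> is
  \<open>h \<Sum>\<^sub>k V\<^sub>k \<bullet> \<partial>H/\<partial>v(Q\<^sub>k, U\<^sub>k, P\<^sub>k\<^sub>-\<^sub>1, t\<^sub>k)\<close>. It vanishes for all \<open>V\<close> if and only if all these
  partial derivatives vanish.\<close>

section \<open>Gradients and fixed points\<close>

text \<open>By Riesz representation the vector \<open>D\<close>, assembled from the values of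
  \<open>g'\<close> on \<open>Basis\<close>, is a gradient, and uniqueness of the Frechet derivative
  makes it the only one. Statements about gradients thus become statements about
  derivatives.\<close>

lemma inner_gradient:
  fixes g :: "'a::euclidean_space \<Rightarrow> real"
  assumes "(g has_derivative g') (at x)"
  shows "y \<bullet> gradient g x = g' y"
proof -
  interpret g': bounded_linear g' using assms by (rule has_derivative_bounded_linear)
  define D where "D = (\<Sum>b\<in>Basis. g' b *\<^sub>R b)"
  have D: "g' y = y \<bullet> D" for y
  proof -
    have "g' y = g' (\<Sum>b\<in>Basis. (y \<bullet> b) *\<^sub>R b)" by (simp add: euclidean_representation)
    also have "\<dots> = (\<Sum>b\<in>Basis. (y \<bullet> b) * g' b)" by (simp add: g'.sum g'.scaleR)
    also have "\<dots> = y \<bullet> D" by (simp add: D_def inner_sum_right mult.commute)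
    finally show ?thesis .
  qed
  have "gradient g x = D"
    unfolding gradient_def
  proof (rule the_equality)
    show "GDERIV g x :> D"
      using assms by (simp add: gderiv_def D[abs_def])
    fix E assume "GDERIV g x :> E"
    then have "(\<lambda>y. y \<bullet> E) = g'"
      unfolding gderiv_def using assms has_derivative_unique by blast
    then have "(E - D) \<bullet> E = (E - D) \<bullet> D" using D by metis
    then show "E = D" by (metis eq_iff_diff_eq_0 inner_diff_right inner_eq_zero_iff)
  qed
  then show ?thesis using D by simp
qed

lemma contraction_ex1_fixed_point:
  fixes F :: "'a::banach \<Rightarrow> 'a"
  assumes "c < 1" "\<And>x y. norm (F x - F y) \<le> c * norm (x - y)"
  shows "\<exists>!x. F x = x"
proof -
  \<comment> \<open>\<open>banach_fix_type\<close> takes a nonnegative constant, whereas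
    \<open>c\<close> may be negative here.\<close>
  have "dist (F x) (F y) \<le> max c 0 * dist x y" for x y
    using assms(2)[of x y] mult_right_mono[of c "max c 0" "norm (x - y)"]
    by (simp add: dist_norm)
  then show ?thesis
    using banach_fix_type[of "max c 0" F] assms(1) by simp
qed

text \<open>The value \<open>F' y\<close> is the limit of difference quotients of norm at most
  \<open>M * norm y\<close>. The bound is asked along the single direction \<open>y\<close> because
  the dynamics is assumed Lipschitz in the state but not in the control.\<close>

lemma lipschitz_has_derivative_bound:
  assumes "(F has_derivative F') (at z)"
    and "\<And>s. norm (F (z + s *\<^sub>R y) - F z) \<le> M * norm (s *\<^sub>R y)"
  shows "norm (F' y) \<le> M * norm y"
proof -
  interpret F': bounded_linear F' using assms(1) by (rule has_derivative_bounded_linear)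
  let ?r = "\<lambda>s. norm (F (z + s *\<^sub>R y) - F z - s *\<^sub>R F' y) / norm s"
  have "((\<lambda>s. F (z + s *\<^sub>R y)) has_derivative (\<lambda>s. F' (s *\<^sub>R y))) (at (0::real))"
    by (rule has_derivative_compose[where g = F]) (auto intro!: derivative_eq_intros assms(1))
  then have "(?r \<longlongrightarrow> 0) (at 0)"
    by (simp add: has_derivative_iff_norm F'.scaleR)
  then have "((\<lambda>s. ?r s + M * norm y) \<longlongrightarrow> 0 + M * norm y) (at 0)"
    by (intro tendsto_add tendsto_const)
  moreover have "norm (F' y) \<le> ?r s + M * norm y" if "s \<noteq> 0" for s
  proof -
    have "norm (s *\<^sub>R F' y) \<le> norm (F (z + s *\<^sub>R y) - F z) + norm (F (z + s *\<^sub>R y) - F z - s *\<^sub>R F' y)"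
      using norm_triangle_ineq4[of "F (z + s *\<^sub>R y) - F z" "F (z + s *\<^sub>R y) - F z - s *\<^sub>R F' y"] by simp
    also have "\<dots> \<le> M * norm (s *\<^sub>R y) + norm (F (z + s *\<^sub>R y) - F z - s *\<^sub>R F' y)"
      using assms(2) by simp
    finally show ?thesis using that by (simp add: field_simps)
  qed
  ultimately have "norm (F' y) \<le> 0 + M * norm y"
    by (intro tendsto_lowerbound[where F = "at (0::real)"]) (auto simp: eventually_at_filter)
  then show ?thesis by simp
qed

lemma has_vector_derivative_affine:
  "((\<lambda>\<epsilon>. x + \<epsilon> *\<^sub>R X) has_vector_derivative X) (at \<epsilon>)"
  by (auto intro!: derivative_eq_intros)

text \<open>The affine map \<open>\<epsilon> \<mapsto> x 0 + \<epsilon>X\<close> solves the fixed point equation up to \<open>o(\<epsilon>)\<close>, so the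
  contraction property keeps it \<open>o(\<epsilon>)\<close>-close to \<open>x\<close>.\<close>

lemma fixed_point_has_vector_derivative:
  fixes x :: "real \<Rightarrow> 'a::real_normed_vector"
  assumes "c < 1" and lip: "\<And>\<epsilon> y z. norm (G \<epsilon> y - G \<epsilon> z) \<le> c * norm (y - z)"
    and fixed: "\<And>\<epsilon>. G \<epsilon> (x \<epsilon>) = x \<epsilon>"
    and G: "((\<lambda>\<epsilon>. G \<epsilon> (x 0 + \<epsilon> *\<^sub>R X)) has_vector_derivative X) (at 0)"
  shows "(x has_vector_derivative X) (at 0)"
proof -
  define y where "y \<epsilon> = x 0 + \<epsilon> *\<^sub>R X" for \<epsilon>
  define R where "R \<epsilon> = G \<epsilon> (y \<epsilon>) - y \<epsilon>" for \<epsilon>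
  have y: "(y has_vector_derivative X) (at 0)"
    unfolding y_def[abs_def] by (rule has_vector_derivative_affine)
  have "(R has_vector_derivative X - X) (at 0)"
    unfolding R_def[abs_def] using G
    by (intro has_vector_derivative_diff y) (simp add: y_def)
  then have "((\<lambda>\<epsilon>. norm (R \<epsilon>) / norm \<epsilon>) \<longlongrightarrow> 0) (at 0)"
    using fixed[of 0] by (simp add: has_vector_derivative_def has_derivative_iff_norm R_def y_def)
  then have lim: "((\<lambda>\<epsilon>. norm (R \<epsilon>) / norm \<epsilon> / (1 - c)) \<longlongrightarrow> 0) (at 0)"
    by (rule tendsto_divide_zero)
  have "norm (x \<epsilon> - y \<epsilon>) \<le> norm (R \<epsilon>) / (1 - c)" for \<epsilon>
  proof -
    have "norm (x \<epsilon> - y \<epsilon>) \<le> norm (G \<epsilon> (x \<epsilon>) - G \<epsilon> (y \<epsilon>)) + norm (R \<epsilon>)"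
      using norm_triangle_ineq[of "G \<epsilon> (x \<epsilon>) - G \<epsilon> (y \<epsilon>)" "R \<epsilon>"] by (simp add: fixed R_def)
    also have "\<dots> \<le> c * norm (x \<epsilon> - y \<epsilon>) + norm (R \<epsilon>)" using lip by simp
    finally show ?thesis using \<open>c < 1\<close> by (simp add: field_simps)
  qed
  then have "norm (x \<epsilon> - x 0 - \<epsilon> *\<^sub>R X) / norm \<epsilon> \<le> norm (R \<epsilon>) / norm \<epsilon> / (1 - c)" for \<epsilon>
    using divide_right_mono[of "norm (x \<epsilon> - y \<epsilon>)" "norm (R \<epsilon>) / (1 - c)" "norm \<epsilon>"]
    by (simp add: y_def diff_diff_eq mult.commute)
  then have "((\<lambda>\<epsilon>. norm (x \<epsilon> - x 0 - \<epsilon> *\<^sub>R X) / norm \<epsilon>) \<longlongrightarrow> 0) (at 0)"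
    by (intro tendsto_sandwich[OF _ _ tendsto_const lim]) auto
  then show ?thesis
    by (simp add: has_vector_derivative_def has_derivative_iff_norm bounded_linear_scaleR_left)
qed

text \<open>At an end time the derivative on the time strip is one-sided in time. The embedding
  \<open>?i\<close> at a fixed time stays inside the strip, so composing with it gives a full
  derivative in the remaining two variables.\<close>

lemma C2_on_differentiable_slice:
  fixes g :: "'a::real_normed_vector \<Rightarrow> 'b::real_normed_vector \<Rightarrow> real \<Rightarrow> 'c::real_normed_vector"
  assumes "C2_on (\<lambda>(x, v, t). g x v t) (UNIV \<times> UNIV \<times> T)" "t \<in> T"
  shows "(\<lambda>(x, v). g x v t) differentiable (at z)"
proof -
  let ?i = "\<lambda>(x::'a, v::'b). (x, v, t)"
  obtain g' where g': "\<And>z. z \<in> UNIV \<times> UNIV \<times> T \<Longrightarrow>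
    ((\<lambda>(x, v, t). g x v t) has_derivative blinfun_apply (g' z)) (at z within UNIV \<times> UNIV \<times> T)"
    using assms(1) unfolding C2_on_def by blast
  have "(?i has_derivative (\<lambda>p. (fst p, snd p, 0))) (at z)"
    unfolding case_prod_unfold by (auto intro!: derivative_eq_intros)
  moreover have "((\<lambda>(x, v, t). g x v t) has_derivative blinfun_apply (g' (?i z)))
      (at (?i z) within range ?i)"
    using g'[of "?i z"] assms(2) by (auto simp: case_prod_unfold intro: has_derivative_subset)
  ultimately have "((\<lambda>p. (\<lambda>(x, v, t). g x v t) (?i p)) has_derivative
      (\<lambda>p. blinfun_apply (g' (?i z)) (fst p, snd p, 0))) (at z)"
    by (rule has_derivative_in_compose)
  then show ?thesis unfolding differentiable_def by (auto simp: case_prod_unfold)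
qed

section \<open>Discrete fractional equations\<close>

lemma gl_coeff_0 [simp]: "gl_coeff \<alpha> 0 = 1"
  by (simp add: gl_coeff_def)

text \<open>The contribution of the past to the implicit scheme: the Caputo difference at
  \<open>k\<close> is \<open>h powr (- \<alpha>)\<close> times
  \<open>G k - memory \<alpha> G k\<close>.\<close>

definition memory :: "real \<Rightarrow> (nat \<Rightarrow> 'a::real_vector) \<Rightarrow> nat \<Rightarrow> 'a" where
  "memory \<alpha> G k = G 0 - (\<Sum>r=1..k. gl_coeff \<alpha> r *\<^sub>R (G (k - r) - G 0))"

lemma memory_cong:
  assumes "\<And>j. j < k \<Longrightarrow> G j = G' j" "1 \<le> k"
  shows "memory \<alpha> G k = memory \<alpha> G' k"
  unfolding memory_def using assms by (intro arg_cong2[where f = minus] sum.cong) auto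

text \<open>The term \<open>r = 0\<close> has coefficient 1 and can be isolated. When
  \<open>y\<close> depends on \<open>G k\<close>, the right-hand form is a fixed point equation for
  \<open>G k\<close>, with contraction constant \<open>h powr \<alpha> * M\<close> if
  \<open>y\<close> is \<open>M\<close>-Lipschitz in \<open>G k\<close>.\<close>

lemma caputo_minus_eq_iff:
  assumes "0 < h"
  shows "caputo_minus h \<alpha> G k = y \<longleftrightarrow> h powr \<alpha> *\<^sub>R y + memory \<alpha> G k = G k"
proof -
  have "{0..k} = insert 0 {1..k}" by auto
  then have "caputo_minus h \<alpha> G k = h powr (- \<alpha>) *\<^sub>R (G k - memory \<alpha> G k)"
    by (simp add: caputo_minus_def memory_def)
  also have "\<dots> = y \<longleftrightarrow> G k - memory \<alpha> G k = h powr \<alpha> *\<^sub>R y"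
    using assms by (simp add: powr_minus) (metis powr_eq_0_iff less_irrefl
        scaleR_scaleR left_inverse scaleR_one right_inverse)
  finally show ?thesis by (auto simp: algebra_simps)
qed

lemma caputo_minus_solution_ex1:
  fixes F :: "nat \<Rightarrow> 'a::banach \<Rightarrow> 'a"
  assumes "0 < h" "h powr \<alpha> * M < 1"
    and lip: "\<And>k x y. k \<in> {1..N} \<Longrightarrow> norm (F k x - F k y) \<le> M * norm (x - y)"
  shows "\<exists>!Q. Q \<in> tuples N \<and> (\<forall>k\<in>{1..N}. caputo_minus h \<alpha> Q k = F k (Q k)) \<and> Q 0 = A"
proof -
  \<comment> \<open>The condition on the value at \<open>k\<close> given the earlier values. Beyond
    \<open>N\<close> it prescribes \<open>undefined\<close>, so that the solution is extensional and
    unique as a function.\<close>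
  define P where "P Q k q \<longleftrightarrow> (if k = 0 then q = A
    else if k \<le> N then h powr \<alpha> *\<^sub>R F k q + memory \<alpha> Q k = q else q = undefined)" for Q k q
  have ex1: "\<exists>!q. P Q k q" for Q k
  proof (cases "k \<in> {1..N}")
    case True
    let ?G = "\<lambda>q. h powr \<alpha> *\<^sub>R F k q + memory \<alpha> Q k"
    have "norm (?G x - ?G y) \<le> h powr \<alpha> * M * norm (x - y)" for x y
      using mult_left_mono[OF lip[OF True, of x y], of "h powr \<alpha>"]
      by (simp flip: scaleR_diff_right)
    from contraction_ex1_fixed_point[OF assms(2) this] True show ?thesis
      by (simp add: P_def)
  next
    case False
    then show ?thesis by (auto simp: P_def)
  qed
  \<comment> \<open>Index 0 is treated apart because \<open>memory \<alpha> Q 0\<close> is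
    \<open>Q 0\<close> itself and not a past value.\<close>
  have adm: "P Q k q = P R k q" if "\<And>j. j < k \<Longrightarrow> Q j = R j" for Q R k q
    using memory_cong[OF that] by (cases "k = 0") (auto simp: P_def)
  have "(Q \<in> tuples N \<and> (\<forall>k\<in>{1..N}. caputo_minus h \<alpha> Q k = F k (Q k)) \<and> Q 0 = A)
      \<longleftrightarrow> (\<forall>k. P Q k (Q k))" (is "?S Q \<longleftrightarrow> _") for Q
    by (auto simp: P_def caputo_minus_eq_iff[OF assms(1)] tuples_def PiE_iff extensional_def)
  moreover have "\<exists>Q. \<forall>k. P Q k (Q k)"
  proof (rule dependent_wf_choice[OF wf_less])
    show "P Q k q = P R k q" if "\<And>j. (j, k) \<in> {(x, y). x < y} \<Longrightarrow> Q j = R j" for Q R k q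
      using that by (intro adm) simp
    show "\<exists>q. P Q k q" for Q k using ex1 by (rule ex1_implies_ex)
  qed
  moreover have "Q = R" if Q: "\<forall>k. P Q k (Q k)" and R: "\<forall>k. P R k (R k)" for Q R
  proof
    show "Q k = R k" for k
    proof (induction k rule: less_induct)
      case (less k)
      then have "P Q k (R k)" using adm[of k Q R] R by simp
      then show ?case using Q ex1[of Q k] by blast
    qed
  qed
  ultimately show ?thesis by (intro ex_ex1I) (simp_all only:)
qed

section \<open>Time reversal and the backward equation\<close>

lemma caputo_plus_eq_caputo_minus:
  assumes "k \<le> N"
  shows "caputo_plus h N \<alpha> G k = caputo_minus h \<alpha> (\<lambda>j\<in>{0..N}. G (N - j)) (N - k)"
  unfolding caputo_plus_def caputo_minus_def using assms
  by (intro arg_cong[where f = "scaleR _"] sum.cong) auto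

lemma reverse_tuple:
  assumes "G \<in> tuples N"
  shows "(\<lambda>j\<in>{0..N}. (\<lambda>i\<in>{0..N}. G (N - i)) (N - j)) = G"
  using assms by (auto simp: tuples_def PiE_iff extensional_def fun_eq_iff)

text \<open>Reversing the index is an involution on tuples that carries the backward equation into a
  forward one with right-hand sides \<open>F (N - k)\<close>, to which the forward result
  applies.\<close>

lemma caputo_plus_solution_ex1:
  fixes F :: "nat \<Rightarrow> 'a::banach \<Rightarrow> 'a"
  assumes "0 < h" "h powr \<alpha> * M < 1"
    and lip: "\<And>k x y. k \<in> {0..<N} \<Longrightarrow> norm (F k x - F k y) \<le> M * norm (x - y)"
  shows "\<exists>!P. P \<in> tuples N \<and> (\<forall>k\<in>{0..<N}. caputo_plus h N \<alpha> P k = F k (P k)) \<and> P N = B"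
proof -
  let ?rev = "\<lambda>G. \<lambda>j\<in>{0..N}. G (N - j) :: 'a"
  let ?S = "\<lambda>P. P \<in> tuples N \<and> (\<forall>k\<in>{0..<N}. caputo_plus h N \<alpha> P k = F k (P k)) \<and> P N = B"
  let ?S' = "\<lambda>Q. Q \<in> tuples N \<and>
    (\<forall>k\<in>{1..N}. caputo_minus h \<alpha> Q k = F (N - k) (Q k)) \<and> Q 0 = B"
  have rev: "?rev G \<in> tuples N" for G by (simp add: tuples_def)
  have ex1: "\<exists>!Q. ?S' Q"
    using assms by (intro caputo_minus_solution_ex1[where M = M]) auto
  then obtain Q where Q: "?S' Q" and unique: "\<And>R. ?S' R \<Longrightarrow> R = Q"
    by (elim ex1E) (rule that, assumption, erule allE, erule mp)
  have iff: "?S P \<longleftrightarrow> ?S' (?rev P)" if "P \<in> tuples N" for P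
  proof -
    \<comment> \<open>Writing \<open>k\<close> as \<open>N - (N - k)\<close> lets the quantifier
      range over the image of the index set under reversal.\<close>
    have "(\<forall>k\<in>{0..<N}. caputo_plus h N \<alpha> P k = F k (P k)) \<longleftrightarrow>
        (\<forall>k\<in>{0..<N}. caputo_minus h \<alpha> (?rev P) (N - k) = F (N - (N - k)) (?rev P (N - k)))"
      by (auto simp: caputo_plus_eq_caputo_minus)
    also have "\<dots> \<longleftrightarrow> (\<forall>k\<in>(\<lambda>k. N - k) ` {0..<N}. caputo_minus h \<alpha> (?rev P) k = F (N - k) (?rev P k))"
      by blast
    also have "(\<lambda>k. N - k) ` {0..<N} = {1..N}"
    proof
      have "k = N - (N - k)" "N - k \<in> {0..<N}" if "k \<in> {1..N}" for k using that by auto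
      then show "{1..N} \<subseteq> (\<lambda>k. N - k) ` {0..<N}" by blast
    qed auto
    finally have eq: "(\<forall>k\<in>{0..<N}. caputo_plus h N \<alpha> P k = F k (P k)) \<longleftrightarrow>
        (\<forall>k\<in>{1..N}. caputo_minus h \<alpha> (?rev P) k = F (N - k) (?rev P k))" .
    have "?rev P 0 = P N" by simp
    then show ?thesis by (simp only: that rev eq simp_thms)
  qed
  have rev_Q: "?rev (?rev Q) = Q" using Q by (intro reverse_tuple) simp
  show ?thesis
  proof (rule ex1I)
    show "?S (?rev Q)" unfolding iff[OF rev] rev_Q by (rule Q)
    fix P assume P: "?S P"
    then have "?S' (?rev P)" using iff by blast
    then have "?rev P = Q" by (rule unique)
    moreover have "?rev (?rev P) = P" using P by (intro reverse_tuple) simp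
    ultimately show "P = ?rev Q" by simp
  qed
qed

text \<open>Both sides are the same double sum over \<open>1 \<le> j \<le> k \<le> N\<close>, summed
  in either order. The condition \<open>X 0 = 0\<close> removes the Caputo correction and the terms
  \<open>j = 0\<close>; \<open>P N = 0\<close> removes the terms \<open>k = N + 1\<close> that the
  shift of \<open>P\<close> produces.\<close>

lemma summation_by_parts:
  fixes X P :: "nat \<Rightarrow> 'a::real_inner"
  assumes "X 0 = 0" "P N = 0"
  shows "(\<Sum>k=1..N. P (k - 1) \<bullet> caputo_minus h \<alpha> X k) =
    (\<Sum>k=1..N. X k \<bullet> delta_plus h N \<alpha> P (k - 1))"
proof -
  let ?g = "\<lambda>k j. gl_coeff \<alpha> (k - j) * (X j \<bullet> P (k - 1))"
  have "P (k - 1) \<bullet> caputo_minus h \<alpha> X k = h powr (- \<alpha>) * (\<Sum>j=1..k. ?g k j)" if "k \<in> {1..N}" for k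
  proof -
    have "(\<Sum>r=0..k. gl_coeff \<alpha> r *\<^sub>R X (k - r)) = (\<Sum>j=0..k. gl_coeff \<alpha> (k - j) *\<^sub>R X j)"
      by (rule sum.reindex_bij_witness[of _ "\<lambda>j. k - j" "\<lambda>j. k - j"]) auto
    also have "\<dots> = (\<Sum>j=1..k. gl_coeff \<alpha> (k - j) *\<^sub>R X j)"
      by (rule sum.mono_neutral_right) (use assms(1) in \<open>auto simp: not_le\<close>)
    finally show ?thesis
      by (simp add: caputo_minus_def assms(1) inner_sum_right inner_commute)
  qed
  moreover have "X j \<bullet> delta_plus h N \<alpha> P (j - 1) = h powr (- \<alpha>) * (\<Sum>k=j..N. ?g k j)"
    if "j \<in> {1..N}" for j
  proof -
    have "(\<Sum>r=0..N - (j - 1). gl_coeff \<alpha> r *\<^sub>R P (j - 1 + r)) =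
        (\<Sum>k=j..N+1. gl_coeff \<alpha> (k - j) *\<^sub>R P (k - 1))"
      by (rule sum.reindex_bij_witness[of _ "\<lambda>k. k - j" "\<lambda>r. r + j"]) (use that in \<open>auto simp: add.commute\<close>)
    also have "\<dots> = (\<Sum>k=j..N. gl_coeff \<alpha> (k - j) *\<^sub>R P (k - 1))"
      by (rule sum.mono_neutral_right) (use assms(2) in \<open>auto simp: le_Suc_eq\<close>)
    finally show ?thesis
      by (simp add: delta_plus_def inner_sum_right)
  qed
  moreover have "(\<Sum>k=1..N. \<Sum>j=1..k. ?g k j) = (\<Sum>j=1..N. \<Sum>k=j..N. ?g k j)"
    unfolding sum.Sigma[OF finite_atLeastAtMost ballI[OF finite_atLeastAtMost]]
    by (rule sum.reindex_bij_witness[of _ "\<lambda>(j, k). (k, j)" "\<lambda>(k, j). (j, k)"]) auto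
  ultimately show ?thesis
    by (simp flip: sum_distrib_left)
qed

section \<open>The derivative of the cost\<close>

locale control_problem =
  fixes a b \<alpha> M :: real and N :: nat and A :: "real^'d::finite"
    and f :: "real^'d \<Rightarrow> real^'m::finite \<Rightarrow> real \<Rightarrow> real^'d"
    and L :: "real^'d \<Rightarrow> real^'m \<Rightarrow> real \<Rightarrow> real"
  assumes ab: "a < b" and N: "1 \<le> N" and M: "0 \<le> M"
    and f_C2: "C2_on (\<lambda>(x, v, t). f x v t) (UNIV \<times> UNIV \<times> {a..b})"
    and f_lipschitz: "t \<in> {a..b} \<Longrightarrow> norm (f x1 v t - f x2 v t) \<le> M * norm (x1 - x2)"
    and L_C2: "C2_on (\<lambda>(x, v, t). L x v t) (UNIV \<times> UNIV \<times> {a..b})"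
    and step: "2 * mesh a b N powr \<alpha> * M < 1"
begin

abbreviation "h \<equiv> mesh a b N"
abbreviation "t \<equiv> node a b N"
text \<open>The derivative is joint in state and control at frozen time, so its values at
  \<open>(y, 0)\<close> and \<open>(0, z)\<close> are the two partial derivatives.\<close>

abbreviation "Df x v s \<equiv> frechet_derivative (\<lambda>(x, v). f x v s) (at (x, v))"
abbreviation "DL x v s \<equiv> frechet_derivative (\<lambda>(x, v). L x v s) (at (x, v))"

lemma h_pos: "0 < h"
  using ab N by (simp add: mesh_def)

lemma contraction: "h powr \<alpha> * M < 1"
  using step M mult_nonneg_nonneg[of "h powr \<alpha>" M] by simp

lemma node_in: "k \<le> N \<Longrightarrow> t k \<in> {a..b}"
proof -
  assume "k \<le> N"
  then have "real k * h \<le> real N * h" using h_pos by (intro mult_right_mono) auto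
  moreover have "real N * h = b - a" using N by (simp add: mesh_def)
  moreover have "0 \<le> real k * h" using h_pos by simp
  ultimately show ?thesis by (auto simp: node_def)
qed

section \<open>Derivatives of the dynamics, the Lagrangian and the Hamiltonian\<close>

lemma has_derivative_f:
  assumes "s \<in> {a..b}"
  shows "((\<lambda>(x, v). f x v s) has_derivative Df x v s) (at (x, v))"
  using C2_on_differentiable_slice[OF f_C2 assms] frechet_derivative_works by blast

lemma has_derivative_L:
  assumes "s \<in> {a..b}"
  shows "((\<lambda>(x, v). L x v s) has_derivative DL x v s) (at (x, v))"
  using C2_on_differentiable_slice[OF L_C2 assms] frechet_derivative_works by blast

lemma linear_Df: "s \<in> {a..b} \<Longrightarrow> linear (Df x v s)"
  using has_derivative_f has_derivative_linear by blast

lemma linear_DL: "s \<in> {a..b} \<Longrightarrow> linear (DL x v s)"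
  using has_derivative_L has_derivative_linear by blast

lemma Df_add: "s \<in> {a..b} \<Longrightarrow> Df x v s (y, z) = Df x v s (y, 0) + Df x v s (0, z)"
  using linear_add[OF linear_Df, of s x v "(y, 0)" "(0, z)"] by simp

lemma DL_add: "s \<in> {a..b} \<Longrightarrow> DL x v s (y, z) = DL x v s (y, 0) + DL x v s (0, z)"
  using linear_add[OF linear_DL, of s x v "(y, 0)" "(0, z)"] by simp

lemma norm_Df_le:
  assumes "s \<in> {a..b}"
  shows "norm (Df x v s (y, 0)) \<le> M * norm y"
proof -
  have "norm (Df x v s (y, 0)) \<le> M * norm (y, 0::real^'m)"
    by (rule lipschitz_has_derivative_bound[OF has_derivative_f[OF assms]])
      \<comment> \<open>The \<open>s\<close> bound by \<open>for s\<close> is the scalar along the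
        direction \<open>y\<close>, not the time.\<close>
      (use f_lipschitz[OF assms, of "x + s *\<^sub>R y" v x for s] in simp)
  then show ?thesis by simp
qed

lemma inner_dH_dx:
  assumes "s \<in> {a..b}"
  shows "y \<bullet> dH_dx L f x v w s = DL x v s (y, 0) + w \<bullet> Df x v s (y, 0)"
proof -
  have pair: "((\<lambda>y. (y, v)) has_derivative (\<lambda>y. (y, 0))) (at x)"
    by (auto intro!: derivative_eq_intros)
  have "((\<lambda>y. hamiltonian L f y v w s) has_derivative
      (\<lambda>y. DL x v s (y, 0) + w \<bullet> Df x v s (y, 0))) (at x)"
    using has_derivative_compose[OF pair has_derivative_L[OF assms]]
      has_derivative_compose[OF pair has_derivative_f[OF assms]]
    unfolding hamiltonian_def by (auto intro!: has_derivative_add has_derivative_inner_right)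
  then show ?thesis unfolding dH_dx_def by (rule inner_gradient)
qed

lemma inner_dH_dv:
  assumes "s \<in> {a..b}"
  shows "y \<bullet> dH_dv L f x v w s = DL x v s (0, y) + w \<bullet> Df x v s (0, y)"
proof -
  have pair: "((\<lambda>y. (x, y)) has_derivative (\<lambda>y. (0, y))) (at v)"
    by (auto intro!: derivative_eq_intros)
  have "((\<lambda>y. hamiltonian L f x y w s) has_derivative
      (\<lambda>y. DL x v s (0, y) + w \<bullet> Df x v s (0, y))) (at v)"
    using has_derivative_compose[OF pair has_derivative_L[OF assms]]
      has_derivative_compose[OF pair has_derivative_f[OF assms]]
    unfolding hamiltonian_def by (auto intro!: has_derivative_add has_derivative_inner_right)
  then show ?thesis unfolding dH_dv_def by (rule inner_gradient)
qed

text \<open>The Hamiltonian is affine in \<open>w\<close> with slope \<open>f x v s\<close>. This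
  identifies the first Pontryagin equation with the state equation.\<close>

lemma dH_dw_eq: "dH_dw L f x v w s = f x v s"
proof -
  have "((\<lambda>w. hamiltonian L f x v w s) has_derivative (\<lambda>y. y \<bullet> f x v s)) (at w)"
    unfolding hamiltonian_def by (auto intro!: derivative_eq_intros)
  from inner_gradient[OF this] show ?thesis
    unfolding dH_dw_def by (metis vector_eq_rdot inner_commute)
qed

text \<open>The difference of the gradients is the transpose of the partial derivative of
  \<open>f\<close> in \<open>x\<close>, applied to \<open>w1 - w2\<close>, and a transpose inherits
  the bound \<open>M\<close>. Concretely, the difference is tested against itself and one factor of
  its norm is cancelled. This makes the adjoint equation a contraction.\<close>

lemma dH_dx_lipschitz:
  assumes "s \<in> {a..b}"
  shows "norm (dH_dx L f x v w1 s - dH_dx L f x v w2 s) \<le> M * norm (w1 - w2)"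
proof -
  let ?g = "dH_dx L f x v w1 s - dH_dx L f x v w2 s"
  have "norm ?g * norm ?g = ?g \<bullet> ?g" by (simp add: dot_square_norm power2_eq_square)
  also have "\<dots> = (w1 - w2) \<bullet> Df x v s (?g, 0)"
    by (subst inner_diff_right) (simp add: inner_dH_dx[OF assms] inner_diff_left)
  also have "\<dots> \<le> norm (w1 - w2) * norm (Df x v s (?g, 0))" by (rule norm_cauchy_schwarz)
  also have "\<dots> \<le> norm (w1 - w2) * (M * norm ?g)"
    by (intro mult_left_mono norm_Df_le[OF assms]) auto
  finally have "norm ?g * norm ?g \<le> M * norm (w1 - w2) * norm ?g" by (simp add: ac_simps)
  then show ?thesis
    using M by (cases "norm ?g = 0") (auto simp: mult_le_cancel_right)
qed

section \<open>Well-posedness of the state and adjoint equations\<close>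

lemma state_ex1:
  "\<exists>!Q. Q \<in> tuples N \<and> (\<forall>k\<in>{1..N}. caputo_minus h \<alpha> Q k = f (Q k) (U k) (t k)) \<and> Q 0 = A"
  by (rule caputo_minus_solution_ex1[OF h_pos contraction, of N "\<lambda>k x. f x (U k) (t k)"])
    (use f_lipschitz node_in in auto)

lemmas state_solution = theI'[OF state_ex1, folded state_def]

lemma state_eqI:
  assumes "Q \<in> tuples N" "\<forall>k\<in>{1..N}. caputo_minus h \<alpha> Q k = f (Q k) (U k) (t k)" "Q 0 = A"
  shows "Q = state a b N \<alpha> A f U"
  using assms state_solution state_ex1 by blast

lemma adjoint_state_ex1:
  "\<exists>!P. P \<in> tuples N \<and> (\<forall>k\<in>{0..<N}. caputo_plus h N \<alpha> P k =
      dH_dx L f (state a b N \<alpha> A f U (k + 1)) (U (k + 1)) (P k) (t (k + 1))) \<and> P N = 0"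
  by (rule caputo_plus_solution_ex1[OF h_pos contraction, of N
        "\<lambda>k p. dH_dx L f (state a b N \<alpha> A f U (k + 1)) (U (k + 1)) p (t (k + 1))"])
    (intro dH_dx_lipschitz node_in, auto)

lemmas adjoint_state_solution = theI'[OF adjoint_state_ex1, folded adjoint_state_def]

lemma adjoint_state_eqI:
  assumes "P \<in> tuples N" "\<forall>k\<in>{0..<N}. caputo_plus h N \<alpha> P k =
      dH_dx L f (state a b N \<alpha> A f U (k + 1)) (U (k + 1)) (P k) (t (k + 1))" "P N = 0"
  shows "P = adjoint_state a b N \<alpha> A L f U"
  using assms adjoint_state_solution adjoint_state_ex1 by blast

section \<open>Perturbation of the control\<close>

abbreviation perturb :: "(nat \<Rightarrow> real^'m) \<Rightarrow> (nat \<Rightarrow> real^'m) \<Rightarrow> real \<Rightarrow> nat \<Rightarrow> real^'m" where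
  "perturb U V \<epsilon> \<equiv> \<lambda>k\<in>{0..N}. U k + \<epsilon> *\<^sub>R V k"

lemma perturb_0: "U \<in> tuples N \<Longrightarrow> perturb U V 0 = U"
  by (auto simp: tuples_def PiE_iff extensional_def fun_eq_iff)

lemma has_vector_derivative_along:
  assumes "(g has_derivative g') (at (x 0, v))"
    and "(x has_vector_derivative X) (at (0::real))"
  shows "((\<lambda>\<epsilon>. g (x \<epsilon>, v + \<epsilon> *\<^sub>R V)) has_vector_derivative g' (X, V)) (at 0)"
proof -
  have "((\<lambda>\<epsilon>. (x \<epsilon>, v + \<epsilon> *\<^sub>R V)) has_vector_derivative (X, V)) (at 0)"
    by (intro has_vector_derivative_Pair assms(2) has_vector_derivative_affine)
  from vector_derivative_diff_chain_within[OF this, of g g'] assms(1) show ?thesis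
    by (auto simp: o_def intro: has_derivative_at_withinI)
qed

text \<open>Induction over time: once the earlier values are differentiable in the perturbation
  parameter, so is the memory term, which is linear in them. The value at \<open>k\<close> is then
  the fixed point of a differentiably perturbed contraction.\<close>

lemma state_has_vector_derivative:
  assumes U: "U \<in> tuples N"
  defines "Q \<equiv> state a b N \<alpha> A f U"
  assumes X: "\<forall>k\<in>{1..N}. caputo_minus h \<alpha> X k = Df (Q k) (U k) (t k) (X k, V k)" "X 0 = 0"
    and "k \<le> N"
  shows "((\<lambda>\<epsilon>. state a b N \<alpha> A f (perturb U V \<epsilon>) k) has_vector_derivative X k) (at 0)"
  using \<open>k \<le> N\<close>
proof (induction k rule: less_induct)
  case (less k)
  let ?x = "\<lambda>\<epsilon>. state a b N \<alpha> A f (perturb U V \<epsilon>)"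
  show ?case
  proof (cases "k = 0")
    case True
    then show ?thesis using X(2) state_solution by simp
  next
    case False
    then have k: "k \<in> {1..N}" using less.prems by simp
    then have tk: "t k \<in> {a..b}" using node_in by simp
    let ?G = "\<lambda>\<epsilon> x. h powr \<alpha> *\<^sub>R f x (U k + \<epsilon> *\<^sub>R V k) (t k) + memory \<alpha> (?x \<epsilon>) k"
    have Q0: "?x 0 k = Q k" by (simp only: perturb_0[OF U] Q_def)
    have lip: "norm (?G \<epsilon> y - ?G \<epsilon> z) \<le> h powr \<alpha> * M * norm (y - z)" for \<epsilon> y z
      using mult_left_mono[OF f_lipschitz[OF tk, of y "U k + \<epsilon> *\<^sub>R V k" z], of "h powr \<alpha>"]
      by (simp flip: scaleR_diff_right)
    have fixed: "?G \<epsilon> (?x \<epsilon> k) = ?x \<epsilon> k" for \<epsilon>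
      using bspec[OF conjunct1[OF conjunct2[OF state_solution[of "perturb U V \<epsilon>"]]] k] k
      by (simp add: caputo_minus_eq_iff[OF h_pos])
    have past: "((\<lambda>\<epsilon>. ?x \<epsilon> j) has_vector_derivative X j) (at 0)" if "j < k" for j
      by (rule less.IH[OF that less_imp_le[OF less_le_trans[OF that less.prems]]])
    have "((\<lambda>\<epsilon>. memory \<alpha> (?x \<epsilon>) k) has_vector_derivative memory \<alpha> X k) (at 0)"
      unfolding memory_def using k
      by (intro has_vector_derivative_diff has_vector_derivative_sum past
          has_vector_derivative_scaleR[where f = "\<lambda>_. gl_coeff \<alpha> _" and f' = 0, simplified]) auto
    moreover have "((\<lambda>\<epsilon>. f (?x 0 k + \<epsilon> *\<^sub>R X k) (U k + \<epsilon> *\<^sub>R V k) (t k))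
        has_vector_derivative Df (Q k) (U k) (t k) (X k, V k)) (at 0)"
      using has_vector_derivative_along[of "\<lambda>(x, v). f x v (t k)" _ "\<lambda>\<epsilon>. ?x 0 k + \<epsilon> *\<^sub>R X k" "U k"
          "X k" "V k"] has_derivative_f[OF tk, of "Q k" "U k"]
      unfolding Q0 by (simp add: has_vector_derivative_affine)
    ultimately have "((\<lambda>\<epsilon>. ?G \<epsilon> (?x 0 k + \<epsilon> *\<^sub>R X k)) has_vector_derivative
        h powr \<alpha> *\<^sub>R Df (Q k) (U k) (t k) (X k, V k) + memory \<alpha> X k) (at 0)"
      by (intro has_vector_derivative_add
          has_vector_derivative_scaleR[where f = "\<lambda>_. h powr \<alpha>" and f' = 0, simplified])
    \<comment> \<open>The linearised equation in fixed point form says exactly that the perturbed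
      map has derivative \<open>X k\<close> along the affine path, as the fixed point lemma
      demands.\<close>
    moreover have "h powr \<alpha> *\<^sub>R Df (Q k) (U k) (t k) (X k, V k) + memory \<alpha> X k = X k"
      using X(1) k by (simp add: caputo_minus_eq_iff[OF h_pos])
    ultimately have "((\<lambda>\<epsilon>. ?G \<epsilon> (?x 0 k + \<epsilon> *\<^sub>R X k)) has_vector_derivative X k) (at 0)"
      by (simp only:)
    then show ?thesis
      by (rule fixed_point_has_vector_derivative[where x = "\<lambda>\<epsilon>. ?x \<epsilon> k" and G = ?G,
          OF contraction lip fixed])
  qed
qed

text \<open>The adjoint equation expresses the derivative of \<open>L\<close> in the state through
  \<open>delta_plus\<close>, and the linearised state equation cancels the derivative of
  \<open>f\<close> in the state. Summation by parts removes what remains of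
  \<open>X\<close>.\<close>

lemma cost_has_derivative:
  assumes U: "U \<in> tuples N"
  defines "Q \<equiv> state a b N \<alpha> A f U"
  assumes P: "\<forall>k\<in>{0..<N}. delta_plus h N \<alpha> P k = dH_dx L f (Q (k + 1)) (U (k + 1)) (P k) (t (k + 1))"
    and "P N = 0"
  shows "((\<lambda>\<epsilon>. cost a b N \<alpha> A L f (perturb U V \<epsilon>)) has_real_derivative
    h * (\<Sum>k=1..N. V k \<bullet> dH_dv L f (Q k) (U k) (P (k - 1)) (t k))) (at 0)"
proof -
  let ?Df = "\<lambda>k. Df (Q k) (U k) (t k)" and ?DL = "\<lambda>k. DL (Q k) (U k) (t k)"
  \<comment> \<open>The linearised equation is affine in \<open>X\<close> with linear part bounded
    by \<open>M\<close>, so the contraction constant of the state equation serves again.\<close>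
  have "\<exists>!X. X \<in> tuples N \<and> (\<forall>k\<in>{1..N}. caputo_minus h \<alpha> X k = ?Df k (X k, V k)) \<and> X 0 = 0"
  proof (rule caputo_minus_solution_ex1[OF h_pos contraction, of N "\<lambda>k x. ?Df k (x, V k)"])
    fix k and x y :: "real^'d" assume "k \<in> {1..N}"
    then have tk: "t k \<in> {a..b}" using node_in by simp
    show "norm (?Df k (x, V k) - ?Df k (y, V k)) \<le> M * norm (x - y)"
      using norm_Df_le[OF tk, of "Q k" "U k" "x - y"]
        linear_diff[OF linear_Df[OF tk], of "Q k" "U k" "(x, V k)" "(y, V k)"] by simp
  qed
  then obtain X where X: "\<forall>k\<in>{1..N}. caputo_minus h \<alpha> X k = ?Df k (X k, V k)" "X 0 = 0"
    by blast
  have "((\<lambda>\<epsilon>. L (state a b N \<alpha> A f (perturb U V \<epsilon>) k) (perturb U V \<epsilon> k) (t k))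
      has_real_derivative ?DL k (X k, V k)) (at 0)" if k: "k \<in> {1..N}" for k
  proof -
    have tk: "t k \<in> {a..b}" using k node_in by simp
    have "((\<lambda>(x, v). L x v (t k)) has_derivative ?DL k)
        (at (state a b N \<alpha> A f (perturb U V 0) k, U k))"
      using has_derivative_L[OF tk, of "Q k" "U k"] by (simp only: perturb_0[OF U] Q_def)
    from has_vector_derivative_along[OF this state_has_vector_derivative[OF U, of X V k]] X k
    show ?thesis by (simp add: Q_def has_real_derivative_iff_has_vector_derivative)
  qed
  then have "((\<lambda>\<epsilon>. cost a b N \<alpha> A L f (perturb U V \<epsilon>)) has_real_derivative
      h * (\<Sum>k=1..N. ?DL k (X k, V k))) (at 0)"
    unfolding cost_def by (intro DERIV_cmult DERIV_sum)
  moreover have "(\<Sum>k=1..N. ?DL k (X k, V k)) =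
      (\<Sum>k=1..N. V k \<bullet> dH_dv L f (Q k) (U k) (P (k - 1)) (t k))"
  proof -
    have "?DL k (X k, V k) = X k \<bullet> delta_plus h N \<alpha> P (k - 1) -
        P (k - 1) \<bullet> caputo_minus h \<alpha> X k + V k \<bullet> dH_dv L f (Q k) (U k) (P (k - 1)) (t k)"
      if k: "k \<in> {1..N}" for k
    proof -
      have tk: "t k \<in> {a..b}" using k node_in by simp
      \<comment> \<open>The adjoint equation at \<open>k - 1\<close> is evaluated at the state and
        control of index \<open>k\<close>; this shift matches the one in the summation by
        parts.\<close>
      have "delta_plus h N \<alpha> P (k - 1) = dH_dx L f (Q k) (U k) (P (k - 1)) (t k)"
        using bspec[OF P, of "k - 1"] k by auto
      moreover have "caputo_minus h \<alpha> X k = ?Df k (X k, 0) + ?Df k (0, V k)"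
        using X(1) k Df_add[OF tk] by metis
      ultimately show ?thesis
        using DL_add[OF tk, of "Q k" "U k" "X k" "V k"]
        by (simp add: inner_dH_dx[OF tk] inner_dH_dv[OF tk] inner_add_right)
    qed
    then show ?thesis
      using summation_by_parts[of X P N h \<alpha>] X(2) \<open>P N = 0\<close>
      by (simp add: sum.distrib sum_subtractf)
  qed
  ultimately show ?thesis by simp
qed

section \<open>Critical points and the Pontryagin system\<close>

lemma critical_point_iff:
  assumes U: "U \<in> tuples N"
  defines "Q \<equiv> state a b N \<alpha> A f U"
  assumes P: "\<forall>k\<in>{0..<N}. delta_plus h N \<alpha> P k = dH_dx L f (Q (k + 1)) (U (k + 1)) (P k) (t (k + 1))"
    and PN: "P N = 0"
  shows "critical_point N (cost a b N \<alpha> A L f) U \<longleftrightarrow>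
    (\<forall>k\<in>{1..N}. dH_dv L f (Q k) (U k) (P (k - 1)) (t k) = 0)"
proof -
  let ?J = "cost a b N \<alpha> A L f"
  let ?g = "\<lambda>k. dH_dv L f (Q k) (U k) (P (k - 1)) (t k)"
  have lim: "((\<lambda>\<epsilon>. (?J (perturb U V \<epsilon>) - ?J U) / \<epsilon>) \<longlongrightarrow> h * (\<Sum>k=1..N. V k \<bullet> ?g k)) (at 0)" for V
    using cost_has_derivative[OF U P[unfolded Q_def] PN, of V]
    unfolding has_field_derivative_iff perturb_0[OF U] Q_def by simp
  have "critical_point N ?J U \<longleftrightarrow> (\<forall>V\<in>tuples N. h * (\<Sum>k=1..N. V k \<bullet> ?g k) = 0)"
  proof -
    have "((\<lambda>\<epsilon>. (?J (perturb U V \<epsilon>) - ?J U) / \<epsilon>) \<longlongrightarrow> 0) (at 0) \<longleftrightarrow>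
        h * (\<Sum>k=1..N. V k \<bullet> ?g k) = 0" (is "(?F \<longlongrightarrow> 0) (at 0) \<longleftrightarrow> ?D = 0") for V
    proof
      assume "(?F \<longlongrightarrow> 0) (at 0)"
      with lim show "?D = 0" by (rule LIM_unique)
    next
      assume D: "?D = 0"
      show "(?F \<longlongrightarrow> 0) (at 0)" by (rule lim[of V, unfolded D])
    qed
    then show ?thesis unfolding critical_point_def by (simp only: U simp_thms)
  qed
  also have "\<dots> \<longleftrightarrow> (\<forall>k\<in>{1..N}. ?g k = 0)"
  proof
    assume *: "\<forall>V\<in>tuples N. h * (\<Sum>k=1..N. V k \<bullet> ?g k) = 0"
    \<comment> \<open>Testing with the gradients themselves as direction turns the derivative into
      \<open>h\<close> times a sum of squares.\<close>
    have "restrict ?g {0..N} \<in> tuples N" by (simp add: tuples_def)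
    with * have "h * (\<Sum>k=1..N. restrict ?g {0..N} k \<bullet> ?g k) = 0" by blast
    then have "(\<Sum>k=1..N. ?g k \<bullet> ?g k) = 0" using h_pos by simp
    then show "\<forall>k\<in>{1..N}. ?g k = 0" by (simp add: sum_nonneg_eq_0_iff)
  qed simp
  finally show ?thesis .
qed

text \<open>The Caputo correction subtracts the final value, which is zero. This reconciles the
  system, stated with \<open>delta_plus\<close>, with the adjoint state, defined by
  \<open>caputo_plus\<close>.\<close>

lemma delta_plus_eq_caputo_plus: "P N = 0 \<Longrightarrow> delta_plus h N \<alpha> P k = caputo_plus h N \<alpha> P k"
  by (simp add: delta_plus_def caputo_plus_def)

text \<open>The equations decouple in order: the first and \<open>Q 0 = A\<close> force
  \<open>Q\<close> to be the state, the second and \<open>P N = 0\<close> then force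
  \<open>P\<close> to be the adjoint state, and the third is criticality of
  \<open>U\<close>.\<close>

lemma pontryagin_solution_iff:
  "pontryagin_solution a b N \<alpha> A L f Q U P \<longleftrightarrow> critical_point N (cost a b N \<alpha> A L f) U \<and>
    Q = state a b N \<alpha> A f U \<and> P = adjoint_state a b N \<alpha> A L f U"
  (is "?S \<longleftrightarrow> ?C \<and> ?Q \<and> ?P")
proof
  assume S: ?S
  then have Q: ?Q
    by (intro state_eqI) (auto simp: pontryagin_solution_def dH_dw_eq)
  moreover have ?P
    using S Q by (intro adjoint_state_eqI)
      (auto simp: pontryagin_solution_def delta_plus_eq_caputo_plus)
  moreover have ?C
    using S Q critical_point_iff[of U P] by (auto simp: pontryagin_solution_def)
  ultimately show "?C \<and> ?Q \<and> ?P" by blast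
next
  assume "?C \<and> ?Q \<and> ?P"
  then show ?S
    using state_solution[of U] adjoint_state_solution[of U] critical_point_iff[of U P]
    by (auto simp: pontryagin_solution_def critical_point_def dH_dw_eq delta_plus_eq_caputo_plus)
qed

end

theorem corollary8:
  fixes a b \<alpha> M :: real and N :: nat and A :: "real^'d"
    and f :: "real^'d \<Rightarrow> real^'m \<Rightarrow> real \<Rightarrow> real^'d"
    and L :: "real^'d \<Rightarrow> real^'m \<Rightarrow> real \<Rightarrow> real"
  assumes "a < b"
    and "0 < \<alpha>" and "\<alpha> \<le> 1"
    and "1 \<le> N"
    and "C2_on (\<lambda>(x, v, t). f x v t) (UNIV \<times> UNIV \<times> {a..b})"
    and "0 \<le> M"
    and "\<And>x1 x2 v t. t \<in> {a..b} \<Longrightarrow> norm (f x1 v t - f x2 v t) \<le> M * norm (x1 - x2)"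
    and "C2_on (\<lambda>(x, v, t). L x v t) (UNIV \<times> UNIV \<times> {a..b})"
    and "2 * mesh a b N powr \<alpha> * M < 1"
  shows "((\<exists>U. critical_point N (cost a b N \<alpha> A L f) U) \<longleftrightarrow>
          (\<exists>Q U P. pontryagin_solution a b N \<alpha> A L f Q U P)) \<and>
         (\<forall>Q U P. pontryagin_solution a b N \<alpha> A L f Q U P \<longrightarrow>
            critical_point N (cost a b N \<alpha> A L f) U \<and>
            Q = state a b N \<alpha> A f U \<and> P = adjoint_state a b N \<alpha> A L f U)"
proof -
  interpret control_problem a b \<alpha> M N A f L
    using assms by unfold_locales auto
  \<comment> \<open>For a critical \<open>U\<close> the witnesses are its state and adjoint
    state.\<close>
  show ?thesis by (simp add: pontryagin_solution_iff)
qed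

end
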